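(* Let $n_1\ge n_2$, $D\in\mathbb{R}^{n_1\times n_2}$, $\lambda>0$, $\mu>0$, and define $f:\mathbb{R}^{n_1\times n_2}\times\mathbb{R}^{n_1\times n_2}\to\mathbb{R}$ by $$f(L,S)=\|L\|_*+\lambda\|S\|_1+\mu\|L+S-D\|_F.$$ Let $L^0\in\mathbb{R}^{n_1\times n_2}$ be arbitrary and let $\{(L^i,S^i)\}_{i\ge1}$ be any sequence generated by the alternating minimization method: for $i=0,1,2,\dots$, $$S^{i+1}\in\arg\min_S\{\lambda\|S\|_1+\mu\|L^i+S-D\|_F\},\qquad L^{i+1}\in\arg\min_L\{\|L\|_*+\mu\|L+S^{i+1}-D\|_F\}.$$ Then the sequence $\{(L^i,S^i)\}$ is bounded, and every cluster point $(\overline L,\overline S)$ of $\{(L^i,S^i)\}$ is a coordinatewise minimum point of $f$. In addition, if $f$ is non-overfitting at $(\overline L,\overline S)$, i.e., $\overline L+\overline S\ne D$, then $(\overline L,\overline S)$ is a minimum point of $f$, i.e., an optimal solution to $\min_{L,S}f(L,S)$.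
   Context: $\|\cdot\|_*$, $\|\cdot\|_F$ are the nuclear and Frobenius norms, and $\|S\|_1=\sum_{i,j}|S_{ij}|$. A point $(x_1,x_2)$ is a coordinatewise minimum point of $f$ if $f(x_1+d_1,x_2)\ge f(x_1,x_2)$ and $f(x_1,x_2+d_2)\ge f(x_1,x_2)$ for all $d_1,d_2$. *)

theory Defs
  imports "HOL-Analysis.Analysis"
begin

text \<open>The eigenspace of \<open>A\<^sup>T A\<close> for the eigenvalue \<open>\<sigma>\<^sup>2\<close>. A number \<open>\<sigma> \<ge> 0\<close> is a singular value
  of \<open>A\<close> iff this space is nonzero, and its dimension is the multiplicity of \<open>\<sigma>\<close>
  (\<open>A\<^sup>T A\<close> is symmetric, so geometric and algebraic multiplicities agree).\<close>

definition singular_space :: "real^'n^'m \<Rightarrow> real \<Rightarrow> (real^'n) set" where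
  "singular_space A \<sigma> = {v. (transpose A ** A) *v v = \<sigma>\<^sup>2 *\<^sub>R v}"

definition singular_values :: "real^'n^'m \<Rightarrow> real set" where
  "singular_values A = {\<sigma>. \<sigma> \<ge> 0 \<and> singular_space A \<sigma> \<noteq> {0}}"

text \<open>The set of singular values carries no multiplicities, hence the factor \<open>dim\<close>.\<close>

definition nuclear_norm :: "real^'n^'m \<Rightarrow> real" where
  "nuclear_norm A = (\<Sum>\<sigma>\<in>singular_values A. real (dim (singular_space A \<sigma>)) * \<sigma>)"

text \<open>The sum above is never the default value of a sum over an infinite set.\<close>

lemma finite_singular_values: "finite (singular_values A)"
proof -
  define M where "M = transpose A ** A"
  have sym: "(M *v x) \<bullet> y = x \<bullet> (M *v y)" for x y
    by (simp add: M_def dot_lmul_matrix[symmetric] matrix_transpose_mul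
        flip: matrix_vector_mul_assoc transpose_matrix_vector)
  have "\<exists>v. v \<noteq> 0 \<and> M *v v = \<sigma>\<^sup>2 *\<^sub>R v" if "\<sigma> \<in> singular_values A" for \<sigma>
    using that by (auto simp: singular_values_def singular_space_def M_def)
  then obtain v where v: "\<And>\<sigma>. \<sigma> \<in> singular_values A \<Longrightarrow> v \<sigma> \<noteq> 0 \<and> M *v v \<sigma> = \<sigma>\<^sup>2 *\<^sub>R v \<sigma>"
    by metis
  have orth: "v \<sigma> \<bullet> v \<tau> = 0"
    if "\<sigma> \<in> singular_values A" "\<tau> \<in> singular_values A" "\<sigma> \<noteq> \<tau>" for \<sigma> \<tau>
  proof -
    have "\<sigma>\<^sup>2 * (v \<sigma> \<bullet> v \<tau>) = \<tau>\<^sup>2 * (v \<sigma> \<bullet> v \<tau>)"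
      using sym[of "v \<sigma>" "v \<tau>"] v[OF that(1)] v[OF that(2)] by simp
    moreover have "\<sigma>\<^sup>2 \<noteq> \<tau>\<^sup>2"
      using that by (auto simp: singular_values_def power2_eq_iff)
    ultimately show ?thesis by simp
  qed
  have inj: "inj_on v (singular_values A)"
    by (rule inj_onI) (metis orth v inner_eq_zero_iff)
  have "pairwise orthogonal (v ` singular_values A)"
    by (auto simp: pairwise_def orthogonal_def intro: orth)
  moreover have "0 \<notin> v ` singular_values A"
    using v by force
  ultimately have "independent (v ` singular_values A)"
    by (rule pairwise_orthogonal_independent)
  then have "finite (v ` singular_values A)"
    by (rule independent_imp_finite)
  then show ?thesis
    using inj by (rule finite_imageD)
qed

definition entrywise_l1_norm :: "real^'n^'m \<Rightarrow> real" where
  "entrywise_l1_norm A = (\<Sum>i\<in>UNIV. \<Sum>j\<in>UNIV. \<bar>A $ i $ j\<bar>)"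

text \<open>The Frobenius norm is the library norm of the type \<open>real^'n^'m\<close>.\<close>

lemma norm_matrix_eq_Frobenius:
  fixes A :: "real^'n^'m"
  shows "norm A = sqrt (\<Sum>i\<in>UNIV. \<Sum>j\<in>UNIV. (A $ i $ j)\<^sup>2)"
  by (simp add: norm_vec_def L2_set_def sum_nonneg)

definition rpca_objective ::
    "real^'n^'m \<Rightarrow> real \<Rightarrow> real \<Rightarrow> (real^'n^'m) \<times> (real^'n^'m) \<Rightarrow> real" where
  "rpca_objective D lam mu = (\<lambda>(L, S).
     nuclear_norm L + lam * entrywise_l1_norm S + mu * norm (L + S - D))"

definition coordinatewise_min_point ::
    "('a::plus \<times> 'b::plus \<Rightarrow> real) \<Rightarrow> 'a \<times> 'b \<Rightarrow> bool" where
  "coordinatewise_min_point f = (\<lambda>(x1, x2).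
     (\<forall>d1. f (x1 + d1, x2) \<ge> f (x1, x2)) \<and> (\<forall>d2. f (x1, x2 + d2) \<ge> f (x1, x2)))"

text \<open>For a sequence in a metric space, the cluster points are the limits of its subsequences.\<close>

definition seq_cluster_point :: "(nat \<Rightarrow> 'a::metric_space) \<Rightarrow> 'a \<Rightarrow> bool" where
  "seq_cluster_point X x \<longleftrightarrow> (\<exists>r. strict_mono r \<and> (X \<circ> r) \<longlonglongrightarrow> x)"

text \<open>The iterates \<open>S 1, L 1, S 2, L 2, \<dots>\<close> of alternating minimization started at \<open>L 0\<close>.
  The value \<open>S 0\<close> is not an iterate and stays unconstrained.\<close>

definition alternating_min ::
    "real^'n^'m \<Rightarrow> real \<Rightarrow> real \<Rightarrow> (nat \<Rightarrow> real^'n^'m) \<Rightarrow> (nat \<Rightarrow> real^'n^'m) \<Rightarrow> bool" where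
  "alternating_min D lam mu L S \<longleftrightarrow> (\<forall>i.
     is_arg_min (\<lambda>X. lam * entrywise_l1_norm X + mu * norm (L i + X - D)) (\<lambda>_. True) (S (Suc i)) \<and>
     is_arg_min (\<lambda>X. nuclear_norm X + mu * norm (X + S (Suc i) - D)) (\<lambda>_. True) (L (Suc i)))"

definition non_overfitting :: "'a::plus \<Rightarrow> 'a \<times> 'a \<Rightarrow> bool" where
  "non_overfitting D = (\<lambda>(L, S). L + S \<noteq> D)"

end

theory Submission
  imports Defs
begin

text \<open>
  Write \<open>f\<close> for the objective. Three properties of the nuclear norm suffice: it is convex, hence
  continuous, it is nonnegative, and it dominates the entries of the matrix.

  They come from a change of description. The spectral theorem for \<open>A\<^sup>T A\<close> provides an orthonormal
  basis \<open>B\<close> whose images \<open>A b\<close> are pairwise orthogonal of lengths the singular values, so that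
  \<open>nuclear_norm A = (\<Sum>b\<in>B. norm (A b))\<close>. Conversely \<open>(\<Sum>c\<in>C. u c \<bullet> A c) \<le> nuclear_norm A\<close>
  for every orthonormal basis \<open>C\<close> and all pairwise orthogonal vectors \<open>u c\<close> of length at most 1,
  which is the duality with the operator norm. Thus the nuclear norm is a maximum of linear
  functions of \<open>A\<close>, and this is convexity.

  Alternating minimization does not increase \<open>f\<close>, so all iterates lie in a sublevel set of \<open>f\<close>,
  and these are bounded. Along a subsequence converging to a cluster point both partial
  minimality conditions pass to the limit by continuity; for the \<open>S\<close>-block, whose minimality
  pairs \<open>S (i + 1)\<close> with the older \<open>L i\<close>, the monotonicity of the values bridges the gap.

  A coordinatewise minimum of \<open>g x + h y + mu * norm (x + y - D)\<close> with convex \<open>g\<close> and \<open>h\<close> is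
  in general no minimum, since the coupling term has a kink at \<open>x + y = D\<close>. Away from the kink the
  coupling term is differentiable, the two partial optimality conditions involve the same
  gradient, and their sum is the optimality condition for the pair.
\<close>

section \<open>Orthonormal bases\<close>

definition orthonormal_basis :: "'a::euclidean_space set \<Rightarrow> bool" where
  "orthonormal_basis B \<longleftrightarrow>
     finite B \<and> pairwise orthogonal B \<and> (\<forall>b\<in>B. norm b = 1) \<and> span B = UNIV"

lemma orthonormal_basis_expansion:
  assumes "orthonormal_basis B"
  shows "(\<Sum>b\<in>B. (x \<bullet> b) *\<^sub>R b) = x"
proof -
  define y where "y = x - (\<Sum>b\<in>B. (x \<bullet> b) *\<^sub>R b)"
  have fin: "finite B" and orth: "pairwise orthogonal B" and one: "\<And>b. b \<in> B \<Longrightarrow> b \<bullet> b = 1"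
    and span: "span B = UNIV"
    using assms by (auto simp: orthonormal_basis_def norm_eq_1)
  have "y \<bullet> c = 0" if c: "c \<in> B" for c
  proof -
    have "(\<Sum>b\<in>B. (x \<bullet> b) *\<^sub>R b) \<bullet> c = (\<Sum>b\<in>B. (x \<bullet> b) * (b \<bullet> c))"
      by (simp add: inner_sum_left)
    also have "\<dots> = (\<Sum>b\<in>B. if b = c then x \<bullet> c else 0)"
      using orth c one by (intro sum.cong) (auto simp: pairwise_def orthogonal_def)
    finally show ?thesis
      using fin c by (simp add: y_def inner_diff_left)
  qed
  then have "orthogonal y z" if "z \<in> span B" for z
    using orthogonal_to_span[OF that, of y] by (simp add: orthogonal_def)
  then have "orthogonal y y" using span by auto
  then show ?thesis by (simp add: y_def orthogonal_self)
qed

lemma orthonormal_basis_parseval: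
  assumes "orthonormal_basis B"
  shows "(\<Sum>b\<in>B. (x \<bullet> b)\<^sup>2) = (norm x)\<^sup>2"
proof -
  have "(norm x)\<^sup>2 = x \<bullet> (\<Sum>b\<in>B. (x \<bullet> b) *\<^sub>R b)"
    by (simp add: orthonormal_basis_expansion[OF assms] power2_norm_eq_inner)
  then show ?thesis by (simp add: inner_sum_right power2_eq_square)
qed

section \<open>Eigenvectors of self-adjoint maps\<close>

text \<open>A maximizer of the Rayleigh quotient is an eigenvector: with \<open>c\<close> the maximal value, the
  quadratic form of \<open>c - f\<close> is nonnegative on \<open>W\<close> and vanishes at the maximizer, hence its
  derivative vanishes there as well.\<close>

lemma self_adjoint_has_eigenvector:
  fixes f :: "'a::euclidean_space \<Rightarrow> 'a"
  assumes lin: "linear f" and sym: "\<And>x y. f x \<bullet> y = x \<bullet> f y"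
    and W: "subspace W" "f ` W \<subseteq> W" "W \<noteq> {0}"
  obtains v c where "v \<in> W" "v \<noteq> 0" "f v = c *\<^sub>R v"
proof -
  have cont: "continuous_on T f" for T
    by (rule linear_continuous_on) (simp add: lin linear_conv_bounded_linear[symmetric])
  obtain w where w: "w \<in> W" "w \<noteq> 0"
    using W subspace_0 by blast
  have "w /\<^sub>R norm w \<in> W \<inter> sphere 0 1"
    using w W by (simp add: subspace_scale)
  moreover have "compact (W \<inter> sphere 0 1)"
    using W(1) by (intro closed_Int_compact closed_subspace) auto
  moreover have "continuous_on (W \<inter> sphere 0 1) (\<lambda>x. f x \<bullet> x)"
    by (intro continuous_intros cont)
  ultimately obtain v where v: "v \<in> W \<inter> sphere 0 1"
    and max: "\<And>x. x \<in> W \<inter> sphere 0 1 \<Longrightarrow> f x \<bullet> x \<le> f v \<bullet> v"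
    using continuous_attains_sup[of "W \<inter> sphere 0 1" "\<lambda>x. f x \<bullet> x"] by blast
  define c where "c = f v \<bullet> v"
  define q where "q x = c * (x \<bullet> x) - f x \<bullet> x" for x
  have q_nonneg: "q x \<ge> 0" if "x \<in> W" for x
  proof (cases "x = 0")
    case True
    then show ?thesis using lin by (simp add: q_def linear_0)
  next
    case False
    define y where "y = x /\<^sub>R norm x"
    have "y \<in> W \<inter> sphere 0 1"
      using that False W by (simp add: y_def subspace_scale)
    then have "f y \<bullet> y \<le> c" using max by (simp add: c_def)
    then have "(norm x)\<^sup>2 * (f y \<bullet> y) \<le> (norm x)\<^sup>2 * c"
      by (intro mult_left_mono) auto
    moreover have "x = norm x *\<^sub>R y" using False by (simp add: y_def)
    then have "f x \<bullet> x = f (norm x *\<^sub>R y) \<bullet> (norm x *\<^sub>R y)" by (rule arg_cong)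
    then have "f x \<bullet> x = (norm x)\<^sup>2 * (f y \<bullet> y)"
      using lin by (simp add: linear_scale power2_eq_square)
    ultimately show ?thesis
      by (simp add: q_def power2_norm_eq_inner mult.commute)
  qed
  have vv: "v \<bullet> v = 1" using v by (simp add: norm_eq_1)
  define z where "z = c *\<^sub>R v - f v"
  have zW: "z \<in> W"
    using v W by (auto simp: z_def intro!: subspace_diff subspace_scale)
  have expand: "q (v + t *\<^sub>R z) = 2 * t * (z \<bullet> z) + t\<^sup>2 * q z" for t
  proof -
    have "f (v + t *\<^sub>R z) = f v + t *\<^sub>R f z"
      using lin by (simp add: linear_add linear_scale)
    then have "q (v + t *\<^sub>R z) = q v + 2 * t * (c * (v \<bullet> z) - f v \<bullet> z) + t\<^sup>2 * q z"
      using sym[of z v]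
      by (simp add: q_def inner_add_left inner_add_right inner_commute algebra_simps
          power2_eq_square)
    moreover have "q v = 0" by (simp add: q_def vv c_def)
    moreover have "c * (v \<bullet> z) - f v \<bullet> z = z \<bullet> z"
      unfolding z_def by (simp add: inner_diff_left inner_diff_right inner_commute algebra_simps)
    ultimately show ?thesis by simp
  qed
  define b where "b = q z"
  have "b \<ge> 0" using q_nonneg[OF zW] by (simp add: b_def)
  define t where "t = - (z \<bullet> z) / (b + 1)"
  \<comment> \<open>A quadratic \<open>2 t a + t\<^sup>2 b\<close> with \<open>a > 0\<close> and \<open>b \<ge> 0\<close> is negative at \<open>t = - a / (b + 1)\<close>.\<close>
  have "0 \<le> 2 * t * (z \<bullet> z) + t\<^sup>2 * b"
    using q_nonneg[of "v + t *\<^sub>R z"] expand[of t] v zW W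
    by (simp add: b_def subspace_add subspace_scale)
  also have "2 * t * (z \<bullet> z) = - 2 * (b + 1) * t\<^sup>2"
  proof -
    have "t * (b + 1) = - (z \<bullet> z)" using \<open>b \<ge> 0\<close> by (simp add: t_def)
    then have "z \<bullet> z = - (t * (b + 1))" by simp
    then show ?thesis by (simp only:) (simp add: power2_eq_square algebra_simps)
  qed
  finally have "(b + 2) * t\<^sup>2 \<le> 0" by (simp add: algebra_simps)
  then have "t = 0" using \<open>b \<ge> 0\<close> by (simp add: mult_le_0_iff)
  then have "z = 0" using \<open>b \<ge> 0\<close> by (simp add: t_def)
  then have "f v = c *\<^sub>R v" by (simp add: z_def)
  with v show thesis by (intro that[of v c]) auto
qed

section \<open>The nuclear norm\<close>

lemma inner_Gram_matrix:
  fixes A :: "real^'n^'m"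
  shows "((transpose A ** A) *v x) \<bullet> y = (A *v x) \<bullet> (A *v y)"
  by (simp only: matrix_vector_mul_assoc[symmetric] transpose_matrix_vector dot_lmul_matrix)

lemma subspace_singular_space: "subspace (singular_space A \<sigma>)"
  by (auto simp: singular_space_def subspace_def algebra_simps matrix_vector_right_distrib)

text \<open>Orthonormal bases of the individual eigenspaces of \<open>A\<^sup>T A\<close> fit together to an orthonormal
  basis of the whole space: otherwise their common orthogonal complement, an invariant subspace,
  would contain one more eigenvector. Its eigenvalue is \<open>(norm (A v))\<^sup>2 / (norm v)\<^sup>2 \<ge> 0\<close> and
  therefore the square of a singular value.\<close>

lemma nuclear_norm_orthonormal_basis:
  fixes A :: "real^'n^'m"
  obtains B where "orthonormal_basis B"
    and "pairwise (\<lambda>b c. orthogonal (A *v b) (A *v c)) B"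
    and "nuclear_norm A = (\<Sum>b\<in>B. norm (A *v b))"
proof -
  let ?M = "transpose A ** A"
  have "\<exists>B. B \<subseteq> singular_space A \<sigma> \<and> pairwise orthogonal B \<and> (\<forall>x\<in>B. norm x = 1) \<and>
      independent B \<and> card B = dim (singular_space A \<sigma>) \<and> span B = singular_space A \<sigma>" for \<sigma>
    using orthonormal_basis_subspace[OF subspace_singular_space[of A \<sigma>]] by metis
  then obtain E where E_sub: "\<And>\<sigma>. E \<sigma> \<subseteq> singular_space A \<sigma>"
    and E_orth: "\<And>\<sigma>. pairwise orthogonal (E \<sigma>)" and E_one: "\<And>\<sigma> x. x \<in> E \<sigma> \<Longrightarrow> norm x = 1"
    and E_ind: "\<And>\<sigma>. independent (E \<sigma>)" and E_card: "\<And>\<sigma>. card (E \<sigma>) = dim (singular_space A \<sigma>)"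
    and E_span: "\<And>\<sigma>. span (E \<sigma>) = singular_space A \<sigma>"
    by metis
  define B where "B = (\<Union>\<sigma>\<in>singular_values A. E \<sigma>)"
  have E_fin: "finite (E \<sigma>)" for \<sigma>
    using E_ind by (rule independent_imp_finite)
  have eig: "?M *v b = \<sigma>\<^sup>2 *\<^sub>R b" if "b \<in> E \<sigma>" for b \<sigma>
    using that E_sub by (auto simp: singular_space_def)
  have sym: "(?M *v x) \<bullet> y = x \<bullet> (?M *v y)" for x y
    by (metis inner_Gram_matrix inner_commute)
  have E_disj: "b \<bullet> c = 0"
    if "b \<in> E \<sigma>" "c \<in> E \<tau>" "\<sigma> \<noteq> \<tau>" "\<sigma> \<in> singular_values A" "\<tau> \<in> singular_values A"
    for b c \<sigma> \<tau>
  proof -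
    have "\<sigma>\<^sup>2 * (b \<bullet> c) = \<tau>\<^sup>2 * (b \<bullet> c)"
      using sym[of b c] eig[OF that(1)] eig[OF that(2)] by simp
    moreover have "\<sigma>\<^sup>2 \<noteq> \<tau>\<^sup>2"
      using that by (auto simp: singular_values_def power2_eq_iff)
    ultimately show ?thesis by simp
  qed
  have B_orth: "b \<bullet> c = 0" if "b \<in> B" "c \<in> B" "b \<noteq> c" for b c
  proof -
    obtain \<sigma> \<tau> where "\<sigma> \<in> singular_values A" "b \<in> E \<sigma>" "\<tau> \<in> singular_values A" "c \<in> E \<tau>"
      using \<open>b \<in> B\<close> \<open>c \<in> B\<close> by (auto simp: B_def)
    then show ?thesis
      using E_disj E_orth \<open>b \<noteq> c\<close> by (cases "\<sigma> = \<tau>") (auto simp: pairwise_def orthogonal_def)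
  qed
  have A_norm: "norm (A *v b) = \<sigma>" if "b \<in> E \<sigma>" "\<sigma> \<in> singular_values A" for b \<sigma>
  proof -
    have "(norm (A *v b))\<^sup>2 = (?M *v b) \<bullet> b"
      by (simp only: inner_Gram_matrix power2_norm_eq_inner)
    also have "\<dots> = \<sigma>\<^sup>2"
      using eig[OF that(1)] E_one[OF that(1)] by (simp add: norm_eq_1)
    finally show ?thesis
      using that by (simp add: singular_values_def)
  qed
  have "span B = UNIV"
  proof (rule ccontr)
    assume "span B \<noteq> UNIV"
    then obtain a where a: "a \<noteq> 0" "\<And>x. x \<in> span B \<Longrightarrow> a \<bullet> x = 0"
      using span_not_UNIV_orthogonal by metis
    define W where "W = {w. \<forall>b\<in>B. w \<bullet> b = 0}"
    have "subspace W"
      by (auto simp: W_def subspace_def inner_add_left)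
    moreover have "(*v) ?M ` W \<subseteq> W"
    proof -
      have "(?M *v w) \<bullet> b = 0" if "w \<in> W" "b \<in> B" for w b
      proof -
        obtain \<sigma> where "b \<in> E \<sigma>" using \<open>b \<in> B\<close> by (auto simp: B_def)
        then show ?thesis using that by (simp only: sym eig) (simp add: W_def)
      qed
      then show ?thesis by (auto simp: W_def)
    qed
    moreover have "W \<noteq> {0}"
      using a by (auto simp: W_def span_base)
    ultimately obtain v c where v: "v \<in> W" "v \<noteq> 0" "?M *v v = c *\<^sub>R v"
      using self_adjoint_has_eigenvector[of "(*v) ?M" W] sym matrix_vector_mul_linear by metis
    have "c * (v \<bullet> v) = (A *v v) \<bullet> (A *v v)"
      using inner_Gram_matrix[of A v v] v(3) by simp
    then have "c \<ge> 0"
      using v(2) by (metis inner_ge_zero inner_gt_zero_iff zero_le_mult_iff not_le)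
    then have mem: "v \<in> singular_space A (sqrt c)"
      using v(3) by (simp add: singular_space_def)
    then have "sqrt c \<in> singular_values A"
      using v(2) \<open>c \<ge> 0\<close> by (auto simp: singular_values_def)
    then have "orthogonal v b" if "b \<in> E (sqrt c)" for b
      using that v(1) by (auto simp: W_def B_def orthogonal_def)
    then have "orthogonal v v"
      using orthogonal_to_span[of v "E (sqrt c)" v] mem E_span by blast
    with v(2) show False by (simp add: orthogonal_self)
  qed
  then have "orthonormal_basis B"
    using B_orth E_one E_fin finite_singular_values[of A]
    by (auto simp: orthonormal_basis_def pairwise_def orthogonal_def B_def)
  moreover have "pairwise (\<lambda>b c. orthogonal (A *v b) (A *v c)) B"
  proof -
    have "(A *v b) \<bullet> (A *v c) = 0" if bc: "b \<in> B" "c \<in> B" "b \<noteq> c" for b c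
    proof -
      obtain \<sigma> where "b \<in> E \<sigma>" using bc by (auto simp: B_def)
      then show ?thesis
        using inner_Gram_matrix[of A b c] eig[of b \<sigma>] B_orth[OF bc] by simp
    qed
    then show ?thesis by (simp add: pairwise_def orthogonal_def)
  qed
  moreover have "nuclear_norm A = (\<Sum>b\<in>B. norm (A *v b))"
  proof -
    have disj: "E \<sigma> \<inter> E \<tau> = {}"
      if "\<sigma> \<in> singular_values A" "\<tau> \<in> singular_values A" "\<sigma> \<noteq> \<tau>" for \<sigma> \<tau>
      using that A_norm by blast
    have "(\<Sum>b\<in>B. norm (A *v b)) = (\<Sum>\<sigma>\<in>singular_values A. \<Sum>b\<in>E \<sigma>. norm (A *v b))"
      unfolding B_def using finite_singular_values E_fin disj by (intro sum.UNION_disjoint) auto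
    also have "\<dots> = nuclear_norm A"
      using A_norm by (auto simp: nuclear_norm_def E_card[symmetric] intro!: sum.cong)
    finally show ?thesis by simp
  qed
  ultimately show thesis by (rule that)
qed

text \<open>The inequality between nuclear and operator norm, \<open>tr (U\<^sup>T A) \<le> nuclear_norm A\<close> for the
  contraction \<open>U\<close> with \<open>U c = u c\<close>. Evaluated in the basis \<open>B\<close> adapted to \<open>A\<close>, the trace is
  \<open>\<Sum>b\<in>B. U b \<bullet> A b\<close>, and \<open>norm (U b) \<le> 1\<close> by Pythagoras and Parseval.\<close>

lemma trace_le_nuclear_norm:
  fixes A :: "real^'n^'m" and u :: "real^'n \<Rightarrow> real^'m"
  assumes C: "orthonormal_basis C"
    and orth: "pairwise (\<lambda>b c. orthogonal (u b) (u c)) C"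
    and le1: "\<And>c. c \<in> C \<Longrightarrow> norm (u c) \<le> 1"
  shows "(\<Sum>c\<in>C. u c \<bullet> (A *v c)) \<le> nuclear_norm A"
proof -
  obtain B where B: "orthonormal_basis B"
    and nuc: "nuclear_norm A = (\<Sum>b\<in>B. norm (A *v b))"
    using nuclear_norm_orthonormal_basis[of A] by metis
  have fin: "finite C" using C by (simp add: orthonormal_basis_def)
  define U where "U b = (\<Sum>c\<in>C. (b \<bullet> c) *\<^sub>R u c)" for b
  have U_le: "norm (U b) \<le> 1" if "b \<in> B" for b
  proof -
    have "pairwise (\<lambda>c d. orthogonal ((b \<bullet> c) *\<^sub>R u c) ((b \<bullet> d) *\<^sub>R u d)) C"
      using orth by (auto simp: pairwise_def orthogonal_def)
    then have "(norm (U b))\<^sup>2 = (\<Sum>c\<in>C. (norm ((b \<bullet> c) *\<^sub>R u c))\<^sup>2)"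
      unfolding U_def by (rule norm_sum_Pythagorean[OF fin])
    also have "\<dots> \<le> (\<Sum>c\<in>C. (b \<bullet> c)\<^sup>2)"
      using le1 by (intro sum_mono)
        (auto simp: power_mult_distrib abs_square_le_1 mult_left_le)
    also have "\<dots> = 1"
      using that B by (simp add: orthonormal_basis_parseval[OF C] orthonormal_basis_def)
    finally show ?thesis by (simp add: abs_square_le_1)
  qed
  have "(\<Sum>c\<in>C. u c \<bullet> (A *v c)) = (\<Sum>c\<in>C. \<Sum>b\<in>B. (c \<bullet> b) * (u c \<bullet> (A *v b)))"
  proof (rule sum.cong[OF refl])
    fix c
    have "A *v c = A *v (\<Sum>b\<in>B. (c \<bullet> b) *\<^sub>R b)"
      by (simp add: orthonormal_basis_expansion[OF B])
    also have "\<dots> = (\<Sum>b\<in>B. (c \<bullet> b) *\<^sub>R (A *v b))"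
      by (simp add: linear_sum[OF matrix_vector_mul_linear] matrix_vector_mult_scaleR)
    finally show "u c \<bullet> (A *v c) = (\<Sum>b\<in>B. (c \<bullet> b) * (u c \<bullet> (A *v b)))"
      by (simp add: inner_sum_right)
  qed
  also have "\<dots> = (\<Sum>b\<in>B. U b \<bullet> (A *v b))"
    by (subst sum.swap) (simp add: U_def inner_sum_left inner_commute[of _ "_ :: real^'n"])
  also have "\<dots> \<le> (\<Sum>b\<in>B. norm (A *v b))"
  proof (rule sum_mono)
    fix b assume "b \<in> B"
    have "U b \<bullet> (A *v b) \<le> norm (U b) * norm (A *v b)"
      by (rule norm_cauchy_schwarz)
    also have "\<dots> \<le> norm (A *v b)"
      using U_le[OF \<open>b \<in> B\<close>] by (simp add: mult_left_le_one_le)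
    finally show "U b \<bullet> (A *v b) \<le> norm (A *v b)" .
  qed
  finally show ?thesis by (simp add: nuc)
qed

text \<open>Normalizing the images of an adapted basis of the convex combination gives a linear function
  that attains the nuclear norm there and bounds it from below at the two end points.\<close>

lemma nuclear_norm_convex: "convex_on UNIV (nuclear_norm :: real^'n^'m \<Rightarrow> real)"
proof (rule convex_onI)
  fix t :: real and X Y :: "real^'n^'m"
  assume t: "0 < t" "t < 1"
  define Z where "Z = (1 - t) *\<^sub>R X + t *\<^sub>R Y"
  obtain B where B: "orthonormal_basis B"
    and orth: "pairwise (\<lambda>b c. orthogonal (Z *v b) (Z *v c)) B"
    and nuc: "nuclear_norm Z = (\<Sum>b\<in>B. norm (Z *v b))"
    by (rule nuclear_norm_orthonormal_basis)
  define u where "u b = (Z *v b) /\<^sub>R norm (Z *v b)" for b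
  have bound: "(\<Sum>b\<in>B. u b \<bullet> (A *v b)) \<le> nuclear_norm A" for A :: "real^'n^'m"
  proof (rule trace_le_nuclear_norm[OF B])
    show "pairwise (\<lambda>b c. orthogonal (u b) (u c)) B"
      using orth by (auto simp: u_def pairwise_def orthogonal_def)
    show "norm (u c) \<le> 1" for c
      by (cases "norm (Z *v c) = 0") (simp_all add: u_def del: norm_eq_zero)
  qed
  have "nuclear_norm Z = (\<Sum>b\<in>B. u b \<bullet> (Z *v b))"
    unfolding nuc
  proof (rule sum.cong[OF refl])
    fix b
    show "norm (Z *v b) = u b \<bullet> (Z *v b)"
      by (cases "norm (Z *v b) = 0")
        (simp_all add: u_def dot_square_norm power2_eq_square del: norm_eq_zero)
  qed
  also have "\<dots> = (1 - t) * (\<Sum>b\<in>B. u b \<bullet> (X *v b)) + t * (\<Sum>b\<in>B. u b \<bullet> (Y *v b))"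
    by (simp add: Z_def matrix_vector_mult_add_rdistrib scaleR_matrix_vector_assoc[symmetric]
        inner_add_right sum.distrib sum_distrib_left)
  also have "\<dots> \<le> (1 - t) * nuclear_norm X + t * nuclear_norm Y"
    using bound t by (intro add_mono mult_left_mono) auto
  finally show "nuclear_norm ((1 - t) *\<^sub>R X + t *\<^sub>R Y)
      \<le> (1 - t) * nuclear_norm X + t * nuclear_norm Y"
    by (simp add: Z_def)
qed auto

lemma norm_le_entrywise_l1_norm: "norm A \<le> entrywise_l1_norm A"
proof -
  have "norm A \<le> (\<Sum>i\<in>UNIV. norm (A $ i))"
    unfolding norm_vec_def by (rule L2_set_le_sum) simp
  also have "\<dots> \<le> entrywise_l1_norm A"
    unfolding entrywise_l1_norm_def by (intro sum_mono norm_le_l1_cart)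
  finally show ?thesis .
qed

text \<open>The constant is not sharp; any bound by a multiple makes the sublevel sets of the nuclear norm
  bounded.\<close>

lemma norm_le_nuclear_norm:
  fixes A :: "real^'n^'m"
  shows "norm A \<le> real (CARD('m) * CARD('n)) * nuclear_norm A"
proof -
  obtain B where B: "orthonormal_basis B"
    and nuc: "nuclear_norm A = (\<Sum>b\<in>B. norm (A *v b))"
    using nuclear_norm_orthonormal_basis[of A] by metis
  have entry: "\<bar>A $ i $ j\<bar> \<le> nuclear_norm A" for i j
  proof -
    have "A *v axis j 1 = A *v (\<Sum>b\<in>B. (axis j 1 \<bullet> b) *\<^sub>R b)"
      by (simp add: orthonormal_basis_expansion[OF B])
    also have "\<dots> = (\<Sum>b\<in>B. (axis j 1 \<bullet> b) *\<^sub>R (A *v b))"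
      by (simp add: linear_sum[OF matrix_vector_mul_linear] matrix_vector_mult_scaleR)
    finally have "norm (A *v axis j 1) \<le> (\<Sum>b\<in>B. norm ((axis j 1 \<bullet> b) *\<^sub>R (A *v b)))"
      by (simp only: norm_sum)
    also have "\<dots> \<le> (\<Sum>b\<in>B. norm (A *v b))"
    proof (rule sum_mono)
      fix b assume "b \<in> B"
      then have "norm b = 1" using B by (simp add: orthonormal_basis_def)
      then have "\<bar>axis j 1 \<bullet> b\<bar> \<le> 1"
        using Cauchy_Schwarz_ineq2[of "axis j 1" b] by simp
      then show "norm ((axis j 1 \<bullet> b) *\<^sub>R (A *v b)) \<le> norm (A *v b)"
        by (simp add: mult_left_le_one_le)
    qed
    finally have "norm (A *v axis j 1) \<le> nuclear_norm A" by (simp add: nuc)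
    moreover have "A $ i $ j = (A *v axis j 1) $ i"
      by (simp add: matrix_vector_mul_component inner_axis)
    ultimately show ?thesis
      using component_le_norm_cart[of "A *v axis j 1" i] by simp
  qed
  have "norm A \<le> entrywise_l1_norm A"
    by (rule norm_le_entrywise_l1_norm)
  also have "\<dots> \<le> (\<Sum>i\<in>(UNIV::'m set). \<Sum>j\<in>(UNIV::'n set). nuclear_norm A)"
    unfolding entrywise_l1_norm_def by (intro sum_mono entry)
  finally show ?thesis by simp
qed

lemma nuclear_norm_nonneg: "0 \<le> nuclear_norm A"
  unfolding nuclear_norm_def
  by (intro sum_nonneg mult_nonneg_nonneg) (simp_all add: singular_values_def)

section \<open>The objective\<close>

lemma entrywise_l1_norm_convex: "convex_on UNIV (entrywise_l1_norm :: real^'n^'m \<Rightarrow> real)"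
proof (rule convex_onI)
  fix t :: real and X Y :: "real^'n^'m"
  assume t: "0 < t" "t < 1"
  have "\<bar>(1 - t) * x + t * y\<bar> \<le> (1 - t) * \<bar>x\<bar> + t * \<bar>y\<bar>" for x y :: real
    using abs_triangle_ineq[of "(1 - t) * x" "t * y"] t by (simp add: abs_mult)
  then have "entrywise_l1_norm ((1 - t) *\<^sub>R X + t *\<^sub>R Y)
      \<le> (\<Sum>i\<in>UNIV. \<Sum>j\<in>UNIV. (1 - t) * \<bar>X $ i $ j\<bar> + t * \<bar>Y $ i $ j\<bar>)"
    unfolding entrywise_l1_norm_def by (intro sum_mono) simp
  also have "\<dots> = (1 - t) * entrywise_l1_norm X + t * entrywise_l1_norm Y"
    by (simp add: entrywise_l1_norm_def sum.distrib sum_distrib_left)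
  finally show "entrywise_l1_norm ((1 - t) *\<^sub>R X + t *\<^sub>R Y)
      \<le> (1 - t) * entrywise_l1_norm X + t * entrywise_l1_norm Y" .
qed auto

lemma continuous_on_rpca_objective:
  fixes D :: "real^'n^'m"
  shows "continuous_on UNIV (rpca_objective D lam mu)"
proof -
  have "continuous_on UNIV (nuclear_norm :: real^'n^'m \<Rightarrow> real)"
    by (intro convex_on_continuous nuclear_norm_convex) simp
  then have L: "continuous_on UNIV (\<lambda>p :: (real^'n^'m) \<times> (real^'n^'m). nuclear_norm (fst p))"
    by (rule continuous_on_compose2) (auto intro: continuous_on_fst continuous_on_id)
  have "continuous_on UNIV (entrywise_l1_norm :: real^'n^'m \<Rightarrow> real)"
    by (intro convex_on_continuous entrywise_l1_norm_convex) simp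
  then have S: "continuous_on UNIV (\<lambda>p :: (real^'n^'m) \<times> (real^'n^'m). entrywise_l1_norm (snd p))"
    by (rule continuous_on_compose2) (auto intro: continuous_on_snd continuous_on_id)
  show ?thesis
    unfolding rpca_objective_def case_prod_unfold by (intro continuous_intros L S)
qed

lemma bounded_rpca_sublevel:
  fixes D :: "real^'n^'m"
  assumes "lam > 0" "mu > 0"
  shows "bounded {p. rpca_objective D lam mu p \<le> c}"
proof -
  have "norm p \<le> real (CARD('m) * CARD('n)) * c + c / lam"
    if p: "rpca_objective D lam mu p \<le> c" for p
  proof -
    obtain X Y where XY: "p = (X, Y)" by (cases p)
    have le: "nuclear_norm X + lam * entrywise_l1_norm Y + mu * norm (X + Y - D) \<le> c"
      using p by (simp add: XY rpca_objective_def)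
    have nonneg: "0 \<le> nuclear_norm X" "0 \<le> lam * entrywise_l1_norm Y"
        "0 \<le> mu * norm (X + Y - D)"
      using assms nuclear_norm_nonneg order_trans[OF norm_ge_zero norm_le_entrywise_l1_norm]
      by (auto intro!: mult_nonneg_nonneg)
    have "norm X \<le> real (CARD('m) * CARD('n)) * nuclear_norm X"
      by (rule norm_le_nuclear_norm)
    also have "\<dots> \<le> real (CARD('m) * CARD('n)) * c"
      using le nonneg by (intro mult_left_mono) linarith+
    finally have X: "norm X \<le> real (CARD('m) * CARD('n)) * c" .
    have "lam * entrywise_l1_norm Y \<le> c" using le nonneg by linarith
    then have "entrywise_l1_norm Y \<le> c / lam"
      using assms by (simp add: pos_le_divide_eq mult.commute)
    then have "norm Y \<le> c / lam"
      using norm_le_entrywise_l1_norm order_trans by blast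
    then show ?thesis
      using X norm_Pair_le[of X Y] by (simp add: XY)
  qed
  then show ?thesis by (auto simp: bounded_iff)
qed

section \<open>Alternating minimization\<close>

text \<open>The minimality of \<open>y (Suc i)\<close> holds for the first block \<open>x i\<close>, which need not
  converge to the cluster point along the same subsequence. What survives is
  \<open>f (x (Suc i), y (Suc i)) \<le> f (x i, z)\<close>: along \<open>r\<close> this is used with the next member
  of the subsequence on the left, which only decreases the left hand side.\<close>

lemma alternating_min_cluster_point:
  fixes f :: "'a::metric_space \<times> 'b::metric_space \<Rightarrow> real"
  assumes cont: "continuous_on UNIV f"
    and min_y: "\<And>i z. f (x i, y (Suc i)) \<le> f (x i, z)"
    and min_x: "\<And>i z. f (x (Suc i), y (Suc i)) \<le> f (z, y (Suc i))"
    and cluster: "seq_cluster_point (\<lambda>i. (x (Suc i), y (Suc i))) (a, b)"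
  shows "f (a, b) \<le> f (z, b)" and "f (a, b) \<le> f (a, w)"
proof -
  define F where "F i = f (x (Suc i), y (Suc i))" for i
  have step: "F (Suc i) \<le> f (x (Suc i), z)" for i z
    using min_x[of "Suc i" "x (Suc i)"] min_y[of "Suc i" z] by (simp add: F_def)
  have dec: "decseq F"
    using step by (auto simp: decseq_Suc_iff F_def)
  obtain r where r: "strict_mono r"
    and lim: "((\<lambda>i. (x (Suc i), y (Suc i))) \<circ> r) \<longlonglongrightarrow> (a, b)"
    using cluster by (auto simp: seq_cluster_point_def)
  have x_lim: "(\<lambda>k. x (Suc (r k))) \<longlonglongrightarrow> a" and y_lim: "(\<lambda>k. y (Suc (r k))) \<longlonglongrightarrow> b"
    using tendsto_fst[OF lim] tendsto_snd[OF lim] by (simp_all add: o_def)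
  have f_lim: "(\<lambda>k. f (p k, q k)) \<longlonglongrightarrow> f (p', q')"
    if "p \<longlonglongrightarrow> p'" "q \<longlonglongrightarrow> q'" for p q p' q'
    using continuous_on_tendsto_compose[OF cont tendsto_Pair[OF that]] by simp
  have F_lim: "(\<lambda>k. F (r k)) \<longlonglongrightarrow> f (a, b)"
    unfolding F_def by (rule f_lim[OF x_lim y_lim])
  show "f (a, b) \<le> f (z, b)"
    by (rule LIMSEQ_le[OF F_lim f_lim[OF tendsto_const y_lim]]) (auto simp: F_def min_x)
  have "F (r (Suc k)) \<le> f (x (Suc (r k)), w)" for k
  proof -
    have "Suc (r k) \<le> r (Suc k)" using r by (simp add: strict_mono_Suc_iff Suc_leI)
    then have "F (r (Suc k)) \<le> F (Suc (r k))" using dec by (simp add: decseq_def)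
    also have "\<dots> \<le> f (x (Suc (r k)), w)" by (rule step)
    finally show ?thesis .
  qed
  then show "f (a, b) \<le> f (a, w)"
    by (intro LIMSEQ_le[OF LIMSEQ_Suc[OF F_lim] f_lim[OF x_lim tendsto_const]]) auto
qed

lemma alternating_min_sublevel:
  fixes f :: "'a \<times> 'b \<Rightarrow> real"
  assumes min_y: "\<And>i z. f (x i, y (Suc i)) \<le> f (x i, z)"
    and min_x: "\<And>i z. f (x (Suc i), y (Suc i)) \<le> f (z, y (Suc i))"
  shows "f (x (Suc i), y (Suc i)) \<le> f (x 1, y 1)"
proof (induction i)
  case (Suc i)
  have "f (x (Suc (Suc i)), y (Suc (Suc i))) \<le> f (x (Suc i), y (Suc (Suc i)))" by (rule min_x)
  also have "\<dots> \<le> f (x (Suc i), y (Suc i))" by (rule min_y)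
  also have "\<dots> \<le> f (x 1, y 1)" by (rule Suc)
  finally show ?case .
qed simp

section \<open>From coordinatewise to global minimality\<close>

text \<open>The first order condition for a convex \<open>g\<close> plus a function with a directional derivative:
  on the segment towards \<open>z\<close>, convexity bounds the increase of \<open>g\<close> by \<open>t * (g z - g x)\<close>;
  divide by \<open>t\<close> and let \<open>t\<close> tend to 0.\<close>

lemma convex_plus_differentiable_minimum:
  fixes g h :: "'a::real_normed_vector \<Rightarrow> real"
  assumes convex: "convex_on UNIV g"
    and deriv: "(h has_derivative h') (at x)"
    and min: "\<And>z. g x + h x \<le> g z + h z"
  shows "0 \<le> g z - g x + h' (z - x)"
proof -
  define \<phi> where "\<phi> t = h (x + t *\<^sub>R (z - x))" for t
  have "((\<lambda>t::real. x + t *\<^sub>R (z - x)) has_derivative (\<lambda>t. 0 + t *\<^sub>R (z - x))) (at 0)"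
    by (intro derivative_intros)
  then have "(\<phi> has_derivative (\<lambda>t. h' (t *\<^sub>R (z - x)))) (at 0)"
    unfolding \<phi>_def
    using has_derivative_compose[of "\<lambda>t. x + t *\<^sub>R (z - x)" _ 0 UNIV h h'] deriv by simp
  moreover have "h' (t *\<^sub>R (z - x)) = h' (z - x) * t" for t
    using has_derivative_linear[OF deriv] by (simp add: linear_scale)
  ultimately have "(\<phi> has_real_derivative h' (z - x)) (at 0)"
    by (simp add: has_field_derivative_def mult_commute_abs)
  then have "((\<lambda>t. (\<phi> t - \<phi> 0) / t) \<longlongrightarrow> h' (z - x)) (at 0)"
    by (simp add: has_field_derivative_iff)
  then have "((\<lambda>t. (\<phi> t - \<phi> 0) / t) \<longlongrightarrow> h' (z - x)) (at_right 0)"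
    by (rule tendsto_within_subset) simp
  then have "((\<lambda>t. g z - g x + (\<phi> t - \<phi> 0) / t) \<longlongrightarrow> g z - g x + h' (z - x)) (at_right 0)"
    by (intro tendsto_add tendsto_const)
  moreover have "\<forall>\<^sub>F t in at_right 0. 0 \<le> g z - g x + (\<phi> t - \<phi> 0) / t"
  proof -
    have "0 \<le> g z - g x + (\<phi> t - \<phi> 0) / t" if t: "0 < t" "t < 1" for t
    proof -
      have "x + t *\<^sub>R (z - x) = (1 - t) *\<^sub>R x + t *\<^sub>R z" by (simp add: algebra_simps)
      then have "g (x + t *\<^sub>R (z - x)) \<le> (1 - t) * g x + t * g z"
        using convex_onD[OF convex, of t x z] t by simp
      then have "0 \<le> t * (g z - g x) + (\<phi> t - \<phi> 0)"
        using min[of "x + t *\<^sub>R (z - x)"] by (simp add: \<phi>_def algebra_simps)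
      then show ?thesis using t by (simp add: field_simps)
    qed
    then show ?thesis
      unfolding eventually_at_right_field by (intro exI[of _ 1]) auto
  qed
  ultimately show ?thesis
    by (rule tendsto_lowerbound) simp
qed

text \<open>The gradient of the coupling term at the given point is \<open>mu *\<^sub>R sgn (a + b - D)\<close>, for
  either block, because the coupling depends on the sum only. The hypothesis \<open>a + b \<noteq> D\<close>
  makes it exist.\<close>

lemma coordinatewise_min_imp_min:
  fixes g h :: "'a::real_inner \<Rightarrow> real"
  assumes g: "convex_on UNIV g" and h: "convex_on UNIV h" and "mu \<ge> 0"
    and ne: "a + b \<noteq> D"
    and min_a: "\<And>z. g a + h b + mu * norm (a + b - D) \<le> g z + h b + mu * norm (z + b - D)"
    and min_b: "\<And>z. g a + h b + mu * norm (a + b - D) \<le> g a + h z + mu * norm (a + z - D)"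
  shows "g a + h b + mu * norm (a + b - D) \<le> g x + h y + mu * norm (x + y - D)"
proof -
  define U where "U = a + b - D"
  have "U \<noteq> 0" using ne by (simp add: U_def)
  have norm_deriv: "(norm has_derivative (\<lambda>d. d \<bullet> sgn U)) (at U)"
    using \<open>U \<noteq> 0\<close> by (rule has_derivative_norm)
  have "((\<lambda>z. z + b - D) has_derivative (\<lambda>d. d + 0 - 0)) (at a)"
    by (intro derivative_intros)
  then have "((\<lambda>z. mu * norm (z + b - D)) has_derivative (\<lambda>d. mu * (d \<bullet> sgn U))) (at a)"
    using has_derivative_compose[of "\<lambda>z. z + b - D" _ a UNIV norm] norm_deriv
    by (intro has_derivative_mult_right) (simp add: U_def)
  moreover have "g a + mu * norm (a + b - D) \<le> g z + mu * norm (z + b - D)" for z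
    using min_a[of z] by simp
  ultimately have 1: "0 \<le> g x - g a + mu * ((x - a) \<bullet> sgn U)"
    by (rule convex_plus_differentiable_minimum[OF g])
  have "((\<lambda>z. a + z - D) has_derivative (\<lambda>d. 0 + d - 0)) (at b)"
    by (intro derivative_intros)
  then have "((\<lambda>z. mu * norm (a + z - D)) has_derivative (\<lambda>d. mu * (d \<bullet> sgn U))) (at b)"
    using has_derivative_compose[of "\<lambda>z. a + z - D" _ b UNIV norm] norm_deriv
    by (intro has_derivative_mult_right) (simp add: U_def)
  moreover have "h b + mu * norm (a + b - D) \<le> h z + mu * norm (a + z - D)" for z
    using min_b[of z] by simp
  ultimately have 2: "0 \<le> h y - h b + mu * ((y - b) \<bullet> sgn U)"
    by (rule convex_plus_differentiable_minimum[OF h])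
  have "norm U + ((x - a) \<bullet> sgn U + (y - b) \<bullet> sgn U) = (x + y - D) \<bullet> sgn U"
  proof -
    have "U \<bullet> sgn U = norm U"
      using \<open>U \<noteq> 0\<close> by (simp add: sgn_div_norm dot_square_norm power2_eq_square)
    moreover have "x + y - D = U + ((x - a) + (y - b))" by (simp add: U_def)
    ultimately show ?thesis by (simp only: inner_add_left)
  qed
  also have "\<dots> \<le> norm (x + y - D)"
    using norm_cauchy_schwarz[of "x + y - D" "sgn U"] \<open>U \<noteq> 0\<close> by (simp add: norm_sgn)
  finally have "mu * (norm U + ((x - a) \<bullet> sgn U + (y - b) \<bullet> sgn U)) \<le> mu * norm (x + y - D)"
    using \<open>mu \<ge> 0\<close> by (rule mult_left_mono)
  with 1 2 show ?thesis by (simp add: U_def algebra_simps)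
qed

theorem theorem4:
  fixes D :: "real^'n2^'n1" and lam mu :: real
    and L S :: "nat \<Rightarrow> real^'n2^'n1"
  assumes "CARD('n1) \<ge> CARD('n2)"
    and "lam > 0" and "mu > 0"
    and "alternating_min D lam mu L S"
  shows "bounded ((\<lambda>i. (L i, S i)) ` {1..}) \<and>
    (\<forall>Lbar Sbar. seq_cluster_point (\<lambda>i. (L (Suc i), S (Suc i))) (Lbar, Sbar) \<longrightarrow>
       coordinatewise_min_point (rpca_objective D lam mu) (Lbar, Sbar) \<and>
       (non_overfitting D (Lbar, Sbar) \<longrightarrow>
          is_arg_min (rpca_objective D lam mu) (\<lambda>_. True) (Lbar, Sbar)))"
proof -
  let ?f = "rpca_objective D lam mu"
  have min_S: "?f (L i, S (Suc i)) \<le> ?f (L i, Z)"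
    and min_L: "?f (L (Suc i), S (Suc i)) \<le> ?f (Z, S (Suc i))" for i Z
    using assms(4)
    by (auto simp: alternating_min_def is_arg_min_def rpca_objective_def not_less)
  have "(\<lambda>i. (L i, S i)) ` {1..} \<subseteq> {p. ?f p \<le> ?f (L 1, S 1)}"
  proof clarify
    fix i :: nat assume "1 \<le> i"
    then obtain k where "i = Suc k" using not0_implies_Suc by fastforce
    then show "?f (L i, S i) \<le> ?f (L 1, S 1)"
      using alternating_min_sublevel[of ?f L S, OF min_S min_L] by simp
  qed
  then have "bounded ((\<lambda>i. (L i, S i)) ` {1..})"
    using bounded_rpca_sublevel[OF assms(2,3)] bounded_subset by blast
  moreover have "coordinatewise_min_point ?f (Lbar, Sbar) \<and>
      (non_overfitting D (Lbar, Sbar) \<longrightarrow> is_arg_min ?f (\<lambda>_. True) (Lbar, Sbar))"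
    if "seq_cluster_point (\<lambda>i. (L (Suc i), S (Suc i))) (Lbar, Sbar)" for Lbar Sbar
  proof -
    note limit = alternating_min_cluster_point[of ?f L S,
        OF continuous_on_rpca_objective min_S min_L that]
    have "convex_on UNIV (\<lambda>S :: real^'n2^'n1. lam * entrywise_l1_norm S)"
      using assms(2) by (intro convex_on_cmul entrywise_l1_norm_convex) simp
    then have "?f (Lbar, Sbar) \<le> ?f (X, Y)" if "Lbar + Sbar \<noteq> D" for X Y
      using coordinatewise_min_imp_min[of nuclear_norm "\<lambda>S. lam * entrywise_l1_norm S" mu
          Lbar Sbar D X Y] limit that assms
      by (simp add: rpca_objective_def nuclear_norm_convex)
    then show ?thesis
      using limit by (auto simp: coordinatewise_min_point_def non_overfitting_def is_arg_min_def
          not_less)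
  qed
  ultimately show ?thesis by blast
qed

end
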